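(* Let $\Omega=(0,\pi)^3$ and let $m,n,p$ be positive integers. Let $X_{0,n,p},Y_{m,0,p},Z_{m,n,0},V_{m,n,p},W_{m,n,p}:\overline\Omega\to\mathbb{R}^3$ be the vector fields defined in the context. Then $$\|X_{0,n,p}\|_{L^\infty(\Omega)}^2=\frac{4\max\{n^2,p^2\}}{\pi^3(n^2+p^2)},\qquad \|Y_{m,0,p}\|_{L^\infty(\Omega)}^2=\frac{4\max\{m^2,p^2\}}{\pi^3(m^2+p^2)},\qquad \|Z_{m,n,0}\|_{L^\infty(\Omega)}^2=\frac{4\max\{m^2,n^2\}}{\pi^3(m^2+n^2)},$$ $$\|V_{m,n,p}\|_{L^\infty(\Omega)}^2=\frac{8\max\{n^2,p^2\}}{\pi^3(n^2+p^2)},\qquad \|W_{m,n,p}\|_{L^\infty(\Omega)}^2=\frac{8\max\{(n^2+p^2)^2,\,m^2n^2,\,m^2p^2\}}{\pi^3(n^2+p^2)(m^2+n^2+p^2)}.$$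
   Context: Write $\xi=(x,y,z)\in\overline\Omega=[0,\pi]^3$. For positive integers $m,n,p$ define $$X_{0,n,p}(\xi)=\frac{2}{\sqrt{\pi^3(n^2+p^2)}}\begin{pmatrix}0\\ p\sin(ny)\cos(pz)\\ -n\cos(ny)\sin(pz)\end{pmatrix},$$ $$Y_{m,0,p}(\xi)=\frac{2}{\sqrt{\pi^3(m^2+p^2)}}\begin{pmatrix}-p\sin(mx)\cos(pz)\\ 0\\ m\cos(mx)\sin(pz)\end{pmatrix},$$ $$Z_{m,n,0}(\xi)=\frac{2}{\sqrt{\pi^3(m^2+n^2)}}\begin{pmatrix}n\sin(mx)\cos(ny)\\ -m\cos(mx)\sin(ny)\\ 0\end{pmatrix},$$ $$V_{m,n,p}(\xi)=\frac{2\sqrt2\,\cos(mx)}{\sqrt{\pi^3(n^2+p^2)}}\begin{pmatrix}0\\ p\sin(ny)\cos(pz)\\ -n\cos(ny)\sin(pz)\end{pmatrix},$$ $$W_{m,n,p}(\xi)=\frac{2\sqrt2}{\sqrt{\pi^3(m^2+n^2+p^2)(n^2+p^2)}}\begin{pmatrix}(n^2+p^2)\sin(mx)\cos(ny)\cos(pz)\\ -mn\cos(mx)\sin(ny)\cos(pz)\\ -mp\cos(mx)\cos(ny)\sin(pz)\end{pmatrix}.$$ For a continuous vector field $F:\overline\Omega\to\mathbb{R}^3$, $\|F\|_{L^\infty(\Omega)}=\max_{\xi\in\overline\Omega}|F(\xi)|$, where $|\cdot|$ is the Euclidean norm on $\mathbb{R}^3$. *)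

theory Defs
  imports "HOL-Analysis.Analysis"
begin

definition Omega :: "(real^3) set" where
  "Omega = box 0 (\<chi> i. pi)"

lemma closure_Omega: "closure Omega = cbox 0 (\<chi> i. pi)"
proof -
  have "(\<chi> i. pi / 2) \<in> Omega"
    by (simp add: Omega_def mem_box_cart)
  then show ?thesis
    unfolding Omega_def by (intro closure_box) auto
qed

definition mode_X :: "nat \<Rightarrow> nat \<Rightarrow> real^3 \<Rightarrow> real^3" where
  "mode_X n p \<xi> = (let y = \<xi> $ 2; z = \<xi> $ 3 in
     (2 / sqrt (pi ^ 3 * (real n ^ 2 + real p ^ 2))) *\<^sub>R
     vector [0,
             real p * sin (real n * y) * cos (real p * z),
             - real n * cos (real n * y) * sin (real p * z)])"

definition mode_Y :: "nat \<Rightarrow> nat \<Rightarrow> real^3 \<Rightarrow> real^3" where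
  "mode_Y m p \<xi> = (let x = \<xi> $ 1; z = \<xi> $ 3 in
     (2 / sqrt (pi ^ 3 * (real m ^ 2 + real p ^ 2))) *\<^sub>R
     vector [- real p * sin (real m * x) * cos (real p * z),
             0,
             real m * cos (real m * x) * sin (real p * z)])"

definition mode_Z :: "nat \<Rightarrow> nat \<Rightarrow> real^3 \<Rightarrow> real^3" where
  "mode_Z m n \<xi> = (let x = \<xi> $ 1; y = \<xi> $ 2 in
     (2 / sqrt (pi ^ 3 * (real m ^ 2 + real n ^ 2))) *\<^sub>R
     vector [real n * sin (real m * x) * cos (real n * y),
             - real m * cos (real m * x) * sin (real n * y),
             0])"

definition mode_V :: "nat \<Rightarrow> nat \<Rightarrow> nat \<Rightarrow> real^3 \<Rightarrow> real^3" where
  "mode_V m n p \<xi> = (let x = \<xi> $ 1; y = \<xi> $ 2; z = \<xi> $ 3 in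
     (2 * sqrt 2 * cos (real m * x) / sqrt (pi ^ 3 * (real n ^ 2 + real p ^ 2))) *\<^sub>R
     vector [0,
             real p * sin (real n * y) * cos (real p * z),
             - real n * cos (real n * y) * sin (real p * z)])"

definition mode_W :: "nat \<Rightarrow> nat \<Rightarrow> nat \<Rightarrow> real^3 \<Rightarrow> real^3" where
  "mode_W m n p \<xi> = (let x = \<xi> $ 1; y = \<xi> $ 2; z = \<xi> $ 3 in
     (2 * sqrt 2 / sqrt (pi ^ 3 * (real m ^ 2 + real n ^ 2 + real p ^ 2) * (real n ^ 2 + real p ^ 2))) *\<^sub>R
     vector [(real n ^ 2 + real p ^ 2) * sin (real m * x) * cos (real n * y) * cos (real p * z),
             - real m * real n * cos (real m * x) * sin (real n * y) * cos (real p * z),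
             - real m * real p * cos (real m * x) * cos (real n * y) * sin (real p * z)])"

text \<open>For fields continuous on the closed cube the supremum below is a maximum
  (lemma \<open>Linf_norm_is_max\<close>). For other fields the value is not meaningful: the
  supremum of an unbounded set of reals is unspecified.\<close>

definition Linf_norm :: "(real^3 \<Rightarrow> real^3) \<Rightarrow> real" where
  "Linf_norm F = (SUP \<xi>\<in>closure Omega. norm (F \<xi>))"

lemma Linf_norm_is_max:
  assumes "continuous_on (closure Omega) F"
  shows "\<exists>\<xi>\<in>closure Omega. Linf_norm F = norm (F \<xi>) \<and>
           (\<forall>\<eta>\<in>closure Omega. norm (F \<eta>) \<le> norm (F \<xi>))"
proof -
  have ne: "closure Omega \<noteq> {}"
  proof -
    have "0 \<in> closure Omega"
      by (simp add: closure_Omega mem_box_cart)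
    then show ?thesis by (metis empty_iff)
  qed
  have "compact (closure Omega)"
    unfolding closure_Omega by (rule compact_cbox)
  from continuous_attains_sup [OF this ne continuous_on_norm [OF assms]]
  obtain \<xi> where \<xi>: "\<xi> \<in> closure Omega" "\<forall>\<eta>\<in>closure Omega. norm (F \<eta>) \<le> norm (F \<xi>)"
    by (rule bexE)
  then have "Linf_norm F = norm (F \<xi>)"
    unfolding Linf_norm_def by (intro cSup_eq_maximum) auto
  with \<xi> show ?thesis by blast
qed

lemma continuous_on_vector3:
  fixes f g h :: "'a::topological_space \<Rightarrow> real"
  assumes "continuous_on S f" "continuous_on S g" "continuous_on S h"
  shows "continuous_on S (\<lambda>x. vector [f x, g x, h x] :: real^3)"
proof -
  have "(\<lambda>x. vector [f x, g x, h x] :: real^3) =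
        (\<lambda>x. \<chi> i. if i = 1 then f x else if i = 2 then g x else h x)"
    by (auto simp: fun_eq_iff vec_eq_iff forall_3)
  moreover have "continuous_on S (\<lambda>x. (\<chi> i. if i = 1 then f x else if i = 2 then g x else h x) :: real^3)"
  proof (rule continuous_on_vec_lambda)
    fix i :: 3
    show "continuous_on S (\<lambda>x. if i = 1 then f x else if i = 2 then g x else h x)"
      using assms by (cases "i = 1"; cases "i = 2") auto
  qed
  ultimately show ?thesis by (simp only:)
qed

lemma continuous_on_modes:
  "continuous_on S (mode_X n p)" "continuous_on S (mode_Y m p)" "continuous_on S (mode_Z m n)"
  "continuous_on S (mode_V m n p)" "continuous_on S (mode_W m n p)"
  unfolding mode_X_def [abs_def] mode_Y_def [abs_def] mode_Z_def [abs_def] mode_V_def [abs_def]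
    mode_W_def [abs_def] Let_def divide_inverse
  by (intro continuous_on_scaleR continuous_on_vector3 continuous_on_mult continuous_on_sin
      continuous_on_cos continuous_on_component continuous_on_const continuous_on_id)+

end

theory Submission
  imports Defs
begin

text \<open>The squared Euclidean norm of each of the five fields has the form
  \<^term>\<open>K * (A * (a * (1 - b) * (1 - c)) + B * ((1 - a) * b * (1 - c)) + C * ((1 - a) * (1 - b) * c))\<close>,
  where \<open>a\<close>, \<open>b\<close>, \<open>c\<close> are the squared sines of the three phases \<open>m x\<close>, \<open>n y\<close>, \<open>p z\<close>
  and the constants \<open>K\<close>, \<open>A\<close>, \<open>B\<close>, \<open>C\<close> are nonnegative. Read \<open>a\<close>, \<open>b\<close>, \<open>c\<close> as probabilities
  of independent events: the three products are the probabilities that exactly the first, exactly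
  the second, or exactly the third event occurs. These cases are disjoint, so the products sum to
  at most \<open>1\<close> and the norm squared is at most \<open>K\<close> times the largest of \<open>A\<close>, \<open>B\<close>, \<open>C\<close>
  (lemma \<open>exactly_one_weighted_le\<close>).

  The bound is sharp: on the coordinate axes one phase can be brought to \<open>pi / 2\<close> while the others
  vanish, which gives one product the value \<open>1\<close> and the others \<open>0\<close>
  (lemma \<open>Linf_norm_trig_sq\<close>).

  The field \<open>W\<close> uses all three constants, and \<open>V\<close> is the case \<open>A = 0\<close>. The fields \<open>X\<close>, \<open>Y\<close>, \<open>Z\<close>
  fit the same pattern once the missing variable is given frequency \<open>0\<close>, since then its sine is
  \<open>0\<close> and its cosine is \<open>1\<close>.\<close>

lemma norm_vector3_sq:
  fixes a b c :: real
  shows "(norm (vector [a, b, c] :: real^3))\<^sup>2 = a\<^sup>2 + b\<^sup>2 + c\<^sup>2"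
  by (simp add: norm_vec_def L2_set_def sum_3)

lemma Linf_norm_sq_eqI:
  assumes le: "\<And>\<xi>. (norm (F \<xi>))\<^sup>2 \<le> M"
    and attained: "\<exists>\<xi>\<in>closure Omega. (norm (F \<xi>))\<^sup>2 = M"
  shows "(Linf_norm F)\<^sup>2 = M"
proof -
  obtain \<xi> where \<xi>: "\<xi> \<in> closure Omega" "(norm (F \<xi>))\<^sup>2 = M"
    using attained by blast
  have "norm (F \<eta>) \<le> norm (F \<xi>)" for \<eta>
    using le[of \<eta>] unfolding \<xi>(2)[symmetric] by (rule power2_le_imp_le) simp
  with \<xi>(1) have "Linf_norm F = norm (F \<xi>)"
    unfolding Linf_norm_def by (intro cSup_eq_maximum) blast+
  then show ?thesis by (simp only: \<xi>(2))
qed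

text \<open>Replacing each constant by \<open>M\<close> reduces the claim to the three products having sum at
  most \<open>1\<close>; expanding \<open>1 = (a + (1 - a)) * (b + (1 - b)) * (c + (1 - c))\<close> shows them among
  eight nonnegative terms.\<close>

lemma exactly_one_weighted_le:
  fixes a b c A B C M :: real
  assumes "0 \<le> a" "a \<le> 1" "0 \<le> b" "b \<le> 1" "0 \<le> c" "c \<le> 1"
    and "A \<le> M" "B \<le> M" "C \<le> M" "0 \<le> M"
  shows "A * (a * (1 - b) * (1 - c)) + B * ((1 - a) * b * (1 - c)) + C * ((1 - a) * (1 - b) * c) \<le> M"
proof -
  let ?u = "a * (1 - b) * (1 - c)" and ?v = "(1 - a) * b * (1 - c)" and ?w = "(1 - a) * (1 - b) * c"
  have nonneg: "0 \<le> ?u" "0 \<le> ?v" "0 \<le> ?w"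
    using assms by (auto intro!: mult_nonneg_nonneg)
  have "0 \<le> a * b * c" "0 \<le> a * b * (1 - c)" "0 \<le> a * (1 - b) * c" "0 \<le> (1 - a) * b * c"
    "0 \<le> (1 - a) * (1 - b) * (1 - c)"
    using assms by (auto intro!: mult_nonneg_nonneg)
  moreover have "1 = ?u + ?v + ?w + a * b * c + a * b * (1 - c) + a * (1 - b) * c + (1 - a) * b * c
      + (1 - a) * (1 - b) * (1 - c)"
    by (simp add: algebra_simps)
  ultimately have total: "?u + ?v + ?w \<le> 1" by linarith
  have "A * ?u + B * ?v + C * ?w \<le> M * ?u + M * ?v + M * ?w"
    by (intro add_mono mult_right_mono assms nonneg)
  also have "\<dots> = M * (?u + ?v + ?w)"
    by (simp add: algebra_simps)
  also have "\<dots> \<le> M"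
    using total \<open>0 \<le> M\<close> by (rule mult_left_le)
  finally show ?thesis .
qed

text \<open>Each constant is attained, up to the factor \<open>K\<close>, where its sine is \<open>1\<close> and the other two
  sines are \<open>0\<close>. A variable of frequency \<open>0\<close> has no such point; the hypothesis \<open>zero\<close> makes its
  constant \<open>0\<close>, and this value is attained at the origin.\<close>

lemma Linf_norm_trig_sq:
  fixes k l q :: nat and A B C K :: real
  assumes norm_eq: "\<And>\<xi>. (norm (F \<xi>))\<^sup>2 = K *
      (A * (sin (real k * \<xi> $ 1) * cos (real l * \<xi> $ 2) * cos (real q * \<xi> $ 3))\<^sup>2 +
       B * (cos (real k * \<xi> $ 1) * sin (real l * \<xi> $ 2) * cos (real q * \<xi> $ 3))\<^sup>2 +
       C * (cos (real k * \<xi> $ 1) * cos (real l * \<xi> $ 2) * sin (real q * \<xi> $ 3))\<^sup>2)"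
    and zero: "k = 0 \<Longrightarrow> A = 0" "l = 0 \<Longrightarrow> B = 0" "q = 0 \<Longrightarrow> C = 0"
    and nonneg: "0 \<le> K" "0 \<le> A" "0 \<le> B" "0 \<le> C"
  shows "(Linf_norm F)\<^sup>2 = K * max A (max B C)"
proof (rule Linf_norm_sq_eqI)
  let ?M = "max A (max B C)"
  fix \<xi> :: "real^3"
  let ?a = "(sin (real k * \<xi> $ 1))\<^sup>2" and ?b = "(sin (real l * \<xi> $ 2))\<^sup>2"
    and ?c = "(sin (real q * \<xi> $ 3))\<^sup>2"
  have le1: "(sin t)\<^sup>2 \<le> 1" for t :: real
    by (simp add: sin_squared_eq)
  have "A * (?a * (1 - ?b) * (1 - ?c)) + B * ((1 - ?a) * ?b * (1 - ?c))
      + C * ((1 - ?a) * (1 - ?b) * ?c) \<le> ?M"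
    using nonneg by (intro exactly_one_weighted_le le1) auto
  then have "K * (A * (?a * (1 - ?b) * (1 - ?c)) + B * ((1 - ?a) * ?b * (1 - ?c))
      + C * ((1 - ?a) * (1 - ?b) * ?c)) \<le> K * ?M"
    using nonneg(1) by (rule mult_left_mono)
  then show "(norm (F \<xi>))\<^sup>2 \<le> K * ?M"
    by (simp only: norm_eq power_mult_distrib cos_squared_eq)
next
  let ?M = "max A (max B C)"
  have in_cube: "vector [x, y, z] \<in> closure Omega"
    if "0 \<le> x" "x \<le> pi" "0 \<le> y" "y \<le> pi" "0 \<le> z" "z \<le> pi" for x y z
    using that by (simp add: closure_Omega mem_box_cart forall_3)
  have quarter: "0 \<le> pi / (2 * real j)" "pi / (2 * real j) \<le> pi" for j
    by (cases j; simp add: field_simps)+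
  have half: "real j * (pi / (2 * real j)) = pi / 2" if "j \<noteq> 0" for j
    using that by simp
  have origin: "\<exists>\<xi>\<in>closure Omega. (norm (F \<xi>))\<^sup>2 = 0"
    by (intro bexI[of _ "vector [0, 0, 0]"] in_cube) (simp_all add: norm_eq)
  have A: "\<exists>\<xi>\<in>closure Omega. (norm (F \<xi>))\<^sup>2 = K * A"
  proof (cases "k = 0")
    case True
    then show ?thesis using origin zero(1) by simp
  next
    case False
    then show ?thesis
      by (intro bexI[of _ "vector [pi / (2 * real k), 0, 0]"] in_cube quarter)
        (simp_all add: norm_eq half)
  qed
  have B: "\<exists>\<xi>\<in>closure Omega. (norm (F \<xi>))\<^sup>2 = K * B"
  proof (cases "l = 0")
    case True
    then show ?thesis using origin zero(2) by simp
  next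
    case False
    then show ?thesis
      by (intro bexI[of _ "vector [0, pi / (2 * real l), 0]"] in_cube quarter)
        (simp_all add: norm_eq half)
  qed
  have C: "\<exists>\<xi>\<in>closure Omega. (norm (F \<xi>))\<^sup>2 = K * C"
  proof (cases "q = 0")
    case True
    then show ?thesis using origin zero(3) by simp
  next
    case False
    then show ?thesis
      by (intro bexI[of _ "vector [0, 0, pi / (2 * real q)]"] in_cube quarter)
        (simp_all add: norm_eq half)
  qed
  show "\<exists>\<xi>\<in>closure Omega. (norm (F \<xi>))\<^sup>2 = K * ?M"
    using A B C by (simp add: max_def)
qed

theorem proposition2p1:
  fixes m n p :: nat
  assumes "m > 0" and "n > 0" and "p > 0"
  shows "(Linf_norm (mode_X n p))\<^sup>2 =
           4 * Max {real n ^ 2, real p ^ 2} / (pi ^ 3 * (real n ^ 2 + real p ^ 2)) \<and>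
         (Linf_norm (mode_Y m p))\<^sup>2 =
           4 * Max {real m ^ 2, real p ^ 2} / (pi ^ 3 * (real m ^ 2 + real p ^ 2)) \<and>
         (Linf_norm (mode_Z m n))\<^sup>2 =
           4 * Max {real m ^ 2, real n ^ 2} / (pi ^ 3 * (real m ^ 2 + real n ^ 2)) \<and>
         (Linf_norm (mode_V m n p))\<^sup>2 =
           8 * Max {real n ^ 2, real p ^ 2} / (pi ^ 3 * (real n ^ 2 + real p ^ 2)) \<and>
         (Linf_norm (mode_W m n p))\<^sup>2 =
           8 * Max {(real n ^ 2 + real p ^ 2) ^ 2, real m ^ 2 * real n ^ 2, real m ^ 2 * real p ^ 2} /
           (pi ^ 3 * (real n ^ 2 + real p ^ 2) * (real m ^ 2 + real n ^ 2 + real p ^ 2))"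
proof -
  \<comment> \<open>The component along each coordinate supplies that coordinate's constant,
    so in \<open>X\<close>, \<open>Y\<close>, \<open>Z\<close>, \<open>V\<close> the frequencies appear crosswise: the \<open>y\<close> component of \<open>X\<close> gives
    \<open>p\<^sup>2\<close> and its \<open>z\<close> component gives \<open>n\<^sup>2\<close>.\<close>
  have X: "(Linf_norm (mode_X n p))\<^sup>2 =
      (4 / (pi ^ 3 * (real n ^ 2 + real p ^ 2))) * max 0 (max (real p ^ 2) (real n ^ 2))"
  proof (rule Linf_norm_trig_sq[where k = 0 and l = n and q = p])
    show "(norm (mode_X n p \<xi>))\<^sup>2 = (4 / (pi ^ 3 * (real n ^ 2 + real p ^ 2))) *
      (0 * (sin (real 0 * \<xi> $ 1) * cos (real n * \<xi> $ 2) * cos (real p * \<xi> $ 3))\<^sup>2 +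
       real p ^ 2 * (cos (real 0 * \<xi> $ 1) * sin (real n * \<xi> $ 2) * cos (real p * \<xi> $ 3))\<^sup>2 +
       real n ^ 2 * (cos (real 0 * \<xi> $ 1) * cos (real n * \<xi> $ 2) * sin (real p * \<xi> $ 3))\<^sup>2)" for \<xi>
      by (simp add: mode_X_def Let_def norm_vector3_sq power_mult_distrib power_divide mult_ac)
  qed (use assms in simp_all)
  have Y: "(Linf_norm (mode_Y m p))\<^sup>2 =
      (4 / (pi ^ 3 * (real m ^ 2 + real p ^ 2))) * max (real p ^ 2) (max 0 (real m ^ 2))"
  proof (rule Linf_norm_trig_sq[where k = m and l = 0 and q = p])
    show "(norm (mode_Y m p \<xi>))\<^sup>2 = (4 / (pi ^ 3 * (real m ^ 2 + real p ^ 2))) *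
      (real p ^ 2 * (sin (real m * \<xi> $ 1) * cos (real 0 * \<xi> $ 2) * cos (real p * \<xi> $ 3))\<^sup>2 +
       0 * (cos (real m * \<xi> $ 1) * sin (real 0 * \<xi> $ 2) * cos (real p * \<xi> $ 3))\<^sup>2 +
       real m ^ 2 * (cos (real m * \<xi> $ 1) * cos (real 0 * \<xi> $ 2) * sin (real p * \<xi> $ 3))\<^sup>2)" for \<xi>
      by (simp add: mode_Y_def Let_def norm_vector3_sq power_mult_distrib power_divide mult_ac)
  qed (use assms in simp_all)
  have Z: "(Linf_norm (mode_Z m n))\<^sup>2 =
      (4 / (pi ^ 3 * (real m ^ 2 + real n ^ 2))) * max (real n ^ 2) (max (real m ^ 2) 0)"
  proof (rule Linf_norm_trig_sq[where k = m and l = n and q = 0])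
    show "(norm (mode_Z m n \<xi>))\<^sup>2 = (4 / (pi ^ 3 * (real m ^ 2 + real n ^ 2))) *
      (real n ^ 2 * (sin (real m * \<xi> $ 1) * cos (real n * \<xi> $ 2) * cos (real 0 * \<xi> $ 3))\<^sup>2 +
       real m ^ 2 * (cos (real m * \<xi> $ 1) * sin (real n * \<xi> $ 2) * cos (real 0 * \<xi> $ 3))\<^sup>2 +
       0 * (cos (real m * \<xi> $ 1) * cos (real n * \<xi> $ 2) * sin (real 0 * \<xi> $ 3))\<^sup>2)" for \<xi>
      by (simp add: mode_Z_def Let_def norm_vector3_sq power_mult_distrib power_divide mult_ac)
  qed (use assms in simp_all)
  have V: "(Linf_norm (mode_V m n p))\<^sup>2 =
      (8 / (pi ^ 3 * (real n ^ 2 + real p ^ 2))) * max 0 (max (real p ^ 2) (real n ^ 2))"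
  proof (rule Linf_norm_trig_sq[where k = m and l = n and q = p])
    show "(norm (mode_V m n p \<xi>))\<^sup>2 = (8 / (pi ^ 3 * (real n ^ 2 + real p ^ 2))) *
      (0 * (sin (real m * \<xi> $ 1) * cos (real n * \<xi> $ 2) * cos (real p * \<xi> $ 3))\<^sup>2 +
       real p ^ 2 * (cos (real m * \<xi> $ 1) * sin (real n * \<xi> $ 2) * cos (real p * \<xi> $ 3))\<^sup>2 +
       real n ^ 2 * (cos (real m * \<xi> $ 1) * cos (real n * \<xi> $ 2) * sin (real p * \<xi> $ 3))\<^sup>2)" for \<xi>
      by (simp add: mode_V_def Let_def norm_vector3_sq power_mult_distrib power_divide mult_ac
        distrib_left add_divide_distrib)
  qed (use assms in simp_all)
  have W: "(Linf_norm (mode_W m n p))\<^sup>2 =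
      (8 / (pi ^ 3 * (real n ^ 2 + real p ^ 2) * (real m ^ 2 + real n ^ 2 + real p ^ 2))) *
      max ((real n ^ 2 + real p ^ 2) ^ 2) (max (real m ^ 2 * real n ^ 2) (real m ^ 2 * real p ^ 2))"
  proof (rule Linf_norm_trig_sq[where k = m and l = n and q = p])
    show "(norm (mode_W m n p \<xi>))\<^sup>2 =
      (8 / (pi ^ 3 * (real n ^ 2 + real p ^ 2) * (real m ^ 2 + real n ^ 2 + real p ^ 2))) *
      ((real n ^ 2 + real p ^ 2) ^ 2 *
        (sin (real m * \<xi> $ 1) * cos (real n * \<xi> $ 2) * cos (real p * \<xi> $ 3))\<^sup>2 +
       (real m ^ 2 * real n ^ 2) * (cos (real m * \<xi> $ 1) * sin (real n * \<xi> $ 2) * cos (real p * \<xi> $ 3))\<^sup>2 +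
       (real m ^ 2 * real p ^ 2) * (cos (real m * \<xi> $ 1) * cos (real n * \<xi> $ 2) * sin (real p * \<xi> $ 3))\<^sup>2)" for \<xi>
      by (simp add: mode_W_def Let_def norm_vector3_sq power_mult_distrib power_divide mult_ac)
  qed (use assms in simp_all)
  show ?thesis
    unfolding X Y Z V W by (simp add: max_absorb2 le_max_iff_disj max.commute max.left_commute)
qed

end
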